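(* Let $A \in \mathbb{R}^{n\times n}$ and $B \in \mathbb{R}^{n \times m}$ be such that the pair $(A,B)$ is controllable, and let $T := n+m$. Let $x(0) \in \mathbb{R}^n$ be arbitrary, and for a sequence of inputs $u(0),u(1),\dots,u(T-1) \in \mathbb{R}^m$ let the states be generated by $x(t+1) = A x(t) + B u(t)$. Let the inputs be selected successively in time according to the following procedure. Select $u(0) \in \mathbb{R}^m$ nonzero. For $t = 1,2,\dots,T-1$, given $u(0),\dots,u(t-1)$ (and hence $x(0),\dots,x(t)$), select $u(t)$ as follows: (a) If $x(t) \notin \operatorname{im} \mathcal{H}_1(x_{[0,t-1]})$, select $u(t) \in \mathbb{R}^m$ arbitrarily. (b) If $x(t) \in \operatorname{im} \mathcal{H}_1(x_{[0,t-1]})$, take some $\xi \in \mathbb{R}^n$ and some nonzero $\eta \in \mathbb{R}^m$ such that $$\begin{bmatrix} \xi^\top & \eta^\top \end{bmatrix} \begin{bmatrix} \mathcal{H}_1(x_{[0,t-1]}) \\ \mathcal{H}_1(u_{[0,t-1]}) \end{bmatrix} = 0,$$ and select $u(t)$ such that $\xi^\top x(t) + \eta^\top u(t) \neq 0$. Then: 1. The procedure can always be carried out: for every $t \in \{1,\dots,T-1\}$ and all inputs $u(0),\dots,u(t-1)$ selected according to the procedure, if $x(t) \in \operatorname{im} \mathcal{H}_1(x_{[0,t-1]})$, then vectors $\xi \in \mathbb{R}^n$ and $\eta \in \mathbb{R}^m$, $\eta \neq 0$, as required in (b) exist. 2. For every input sequence $u(0),\dots,u(T-1)$ obtained from the procedure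 (for any choices made in it), $$\operatorname{rank} \begin{bmatrix} \mathcal{H}_1(x_{[0,T-1]}) \\ \mathcal{H}_1(u_{[0,T-1]}) \end{bmatrix} = n+m.$$
   Context: $n, m \geq 1$ are integers. For a signal $f$ with values in $\mathbb{R}^q$ and integers $i \le j$, $f_{[i,j]}$ denotes the sequence $f(i), f(i+1), \dots, f(j)$, and $\mathcal{H}_1(f_{[i,j]}) := \begin{bmatrix} f(i) & f(i+1) & \cdots & f(j) \end{bmatrix} \in \mathbb{R}^{q \times (j-i+1)}$ is the Hankel matrix of depth $1$ (the matrix whose columns are the samples). $\operatorname{im}$ denotes the column space of a matrix. The pair $(A,B)$ is controllable if $\operatorname{rank}\begin{bmatrix} B & AB & \cdots & A^{n-1}B\end{bmatrix} = n$. *)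

theory Defs
  imports "Jordan_Normal_Form.DL_Rank"
begin

definition controllability_mat :: "nat \<Rightarrow> real mat \<Rightarrow> real mat \<Rightarrow> real mat" where
  "controllability_mat n A B =
     mat_of_cols n (concat (map (\<lambda>k. cols (A ^\<^sub>m k * B)) [0..<n]))"

definition controllable :: "nat \<Rightarrow> real mat \<Rightarrow> real mat \<Rightarrow> bool" where
  "controllable n A B \<longleftrightarrow> vec_space.rank n (controllability_mat n A B) = n"

definition hankel1 :: "nat \<Rightarrow> (nat \<Rightarrow> real vec) \<Rightarrow> nat \<Rightarrow> nat \<Rightarrow> real mat" where
  "hankel1 q f i j = mat_of_cols q (map f [i..<Suc j])"

primrec state :: "real mat \<Rightarrow> real mat \<Rightarrow> real vec \<Rightarrow> (nat \<Rightarrow> real vec) \<Rightarrow> nat \<Rightarrow> real vec" where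
  "state A B x0 u 0 = x0"
| "state A B x0 u (Suc t) = A *\<^sub>v state A B x0 u t + B *\<^sub>v u t"

definition in_past_span :: "nat \<Rightarrow> (nat \<Rightarrow> real vec) \<Rightarrow> nat \<Rightarrow> bool" where
  "in_past_span n x t \<longleftrightarrow> x t \<in> vec_space.col_space n (hankel1 n x 0 (t - 1))"

definition annihilating_pair ::
  "nat \<Rightarrow> nat \<Rightarrow> (nat \<Rightarrow> real vec) \<Rightarrow> (nat \<Rightarrow> real vec) \<Rightarrow> nat \<Rightarrow> real vec \<Rightarrow> real vec \<Rightarrow> bool" where
  "annihilating_pair n m x u t \<xi> \<eta> \<longleftrightarrow>
     \<xi> \<in> carrier_vec n \<and> \<eta> \<in> carrier_vec m \<and> \<eta> \<noteq> 0\<^sub>v m \<and>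
     mat_of_row (\<xi> @\<^sub>v \<eta>) * (hankel1 n x 0 (t - 1) @\<^sub>r hankel1 m u 0 (t - 1)) = 0\<^sub>m 1 t"

definition admissible_input ::
  "nat \<Rightarrow> nat \<Rightarrow> (nat \<Rightarrow> real vec) \<Rightarrow> (nat \<Rightarrow> real vec) \<Rightarrow> nat \<Rightarrow> bool" where
  "admissible_input n m x u t \<longleftrightarrow>
     (in_past_span n x t \<longrightarrow>
        (\<exists>\<xi> \<eta>. annihilating_pair n m x u t \<xi> \<eta> \<and> \<xi> \<bullet> x t + \<eta> \<bullet> u t \<noteq> 0))"

(* The inputs u 0, ..., u (k - 1) (for k \<ge> 1) are a possible outcome of the first k selections;
   the values u s for s \<ge> k are irrelevant. *)
definition selected_inputs ::
  "nat \<Rightarrow> nat \<Rightarrow> real mat \<Rightarrow> real mat \<Rightarrow> real vec \<Rightarrow> (nat \<Rightarrow> real vec) \<Rightarrow> nat \<Rightarrow> bool" where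
  "selected_inputs n m A B x0 u k \<longleftrightarrow>
     (\<forall>t<k. u t \<in> carrier_vec m) \<and> u 0 \<noteq> 0\<^sub>v m \<and>
     (\<forall>t\<in>{1..<k}. admissible_input n m (state A B x0 u) u t)"

end

theory Submission
  imports Defs
begin

text \<open>
  Write \<open>w t\<close> for the stacked sample \<open>x t @\<^sub>v u t\<close>. For the rank, consider a nonzero kernel vector
  of the sample matrix and its last nonzero entry, at index \<open>k\<close>;
  \<open>k > 0\<close> since \<open>u 0 \<noteq> 0\<close>. Then \<open>w k\<close> is a combination of
  the earlier samples, hence so is \<open>x k\<close>; so \<open>u k\<close> was chosen by rule (b), and the functional
  \<open>(\<xi>, \<eta>)\<close> vanishes on the earlier samples but not on \<open>w k\<close>, a contradiction.

  For the feasibility of rule (b), fewer than \<open>n + m\<close> samples have a nonzero annihilator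
  \<open>(\<xi>, \<eta>)\<close>. Suppose all annihilators have \<open>\<eta> = 0\<close>. Then \<open>\<xi>\<close> annihilates \<open>x 0, \<dots>, x (t - 1)\<close>, and
  also \<open>x t\<close>, which lies in their span; by the dynamics \<open>(A\<^sup>T \<xi>, B\<^sup>T \<xi>)\<close> is again an annihilator,
  so \<open>B\<^sup>T \<xi> = 0\<close>. Iterating, \<open>\<xi>\<close> is orthogonal to all columns of all \<open>A\<^sup>k B\<close>, which contradicts
  controllability.
\<close>

section \<open>Linear algebra: orthogonal vectors and full rank\<close>

text \<open>Taken as rows of a square matrix padded with zero rows, fewer than \<open>N\<close>
  vectors give determinant 0; a kernel vector of that matrix is orthogonal to all of them.\<close>

lemma exists_orthogonal_vec:
  fixes w :: "nat \<Rightarrow> 'a :: field vec"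
  assumes w: "\<And>s. s < t \<Longrightarrow> w s \<in> carrier_vec N" and tN: "t < N"
  shows "\<exists>z\<in>carrier_vec N. z \<noteq> 0\<^sub>v N \<and> (\<forall>s<t. z \<bullet> w s = 0)"
proof -
  \<comment> \<open>\<open>w\<close> is constrained only below \<open>t\<close>; extending it by
    zero puts every row into the carrier, as \<open>det_row_0\<close> requires.\<close>
  define c where "c i = (if i < t then w i else 0\<^sub>v N)" for i
  define M where "M = mat\<^sub>r N N (\<lambda>i. if i = t then 0\<^sub>v N else c i)"
  have c: "c i \<in> carrier_vec N" for i using w by (auto simp: c_def)
  have M: "M \<in> carrier_mat N N" by (simp add: M_def)
  have "det M = 0" unfolding M_def by (rule det_row_0[OF tN]) (use c in auto)
  then obtain z where z: "z \<in> carrier_vec N" "z \<noteq> 0\<^sub>v N" "M *\<^sub>v z = 0\<^sub>v N"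
    using det_0_iff_vec_prod_zero_field[OF M] by auto
  have "z \<bullet> w s = 0" if s: "s < t" for s
  proof -
    have "row M s = w s"
      using s tN w[OF s] by (intro eq_vecI) (auto simp: M_def c_def mat_of_row_def)
    moreover have "(M *\<^sub>v z) $ s = 0" using z s tN by simp
    ultimately have "w s \<bullet> z = 0" using M s tN by simp
    then show ?thesis using comm_scalar_prod[OF w[OF s] z(1)] by simp
  qed
  then show ?thesis using z by blast
qed

text \<open>Full rank makes the columns span the whole space, so each unit vector is some
  \<open>M *\<^sub>v y\<close>; pairing it with \<open>z\<close> gives \<open>z $ i\<close>, and
  moving \<open>M\<close> to the other side gives 0.\<close>

lemma full_rank_orthogonal_zero:
  fixes M :: "'a :: field mat"
  assumes M: "M \<in> carrier_mat n nc" and rk: "vec_space.rank n M = n"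
    and z: "z \<in> carrier_vec n" and orth: "\<And>c. c \<in> set (cols M) \<Longrightarrow> z \<bullet> c = 0"
  shows "z = 0\<^sub>v n"
proof -
  interpret vec_space "TYPE('a)" n .
  \<comment> \<open>The rank is the size of a maximal independent set of columns; with
    \<open>n\<close> elements such a set is a basis.\<close>
  obtain S where S: "finite S" "maximal S (\<lambda>T. T \<subseteq> set (cols M) \<and> lin_indpt T)"
    using maximal_exists_superset[of "set (cols M)" "\<lambda>T. T \<subseteq> set (cols M) \<and> lin_indpt T" "{}"]
    by (auto simp: lin_dep_def)
  have cM: "set (cols M) \<subseteq> carrier_vec n" using M cols_dim by blast
  have SM: "S \<subseteq> set (cols M)" "lin_indpt S" using S(2) by (auto simp: maximal_def)
  have "card S = n" using rank_card_indpt[OF M S(2)] rk by simp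
  then have "basis S"
    using dim_li_is_basis[of S] S(1) SM cM dim_is_n fin_dim by auto
  then have "span S = carrier_vec n" by (simp add: basis_def)
  then have full: "col_space M = carrier_vec n"
    using span_is_monotone[OF SM(1)] span_closed[OF cM] unfolding col_space_def by blast
  have "z $ i = 0" if i: "i < n" for i
  proof -
    have "unit_vec n i \<in> col_space M" by (simp add: full)
    then obtain y where y: "y \<in> carrier_vec nc" "M *\<^sub>v y = unit_vec n i"
      using col_space_eq[OF M] M by auto
    have "z $ i = z \<bullet> (M *\<^sub>v y)" using z i y by simp
    also have "\<dots> = (transpose_mat M *\<^sub>v z) \<bullet> y"
      using transpose_vec_mult_scalar[OF M y(1) z] by simp
    also have "transpose_mat M *\<^sub>v z = 0\<^sub>v nc"
      using M orth z cM
      by (intro eq_vecI) (auto simp: cols_def comm_scalar_prod[OF _ z])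
    finally show ?thesis using y by simp
  qed
  then show ?thesis using z by (intro eq_vecI) auto
qed

section \<open>Depth-one Hankel matrices and the selection conditions\<close>

lemma hankel1_carrier [simp]: "hankel1 q f i j \<in> carrier_mat q (Suc j - i)"
  unfolding hankel1_def by (rule carrier_matI) (simp_all del: upt_Suc)

lemma hankel1_dim:
  "dim_row (hankel1 q f i j) = q" "dim_col (hankel1 q f i j) = Suc j - i"
  by (simp_all only: carrier_matD[OF hankel1_carrier])

lemma hankel1_index:
  "r < q \<Longrightarrow> s < Suc j - i \<Longrightarrow> hankel1 q f i j $$ (r, s) = f (i + s) $ r"
  by (simp add: hankel1_def mat_of_cols_def del: upt_Suc)

text \<open>Lets the stacked data be treated as one matrix whose columns are the joint samples. The
  carrier assumptions align the two splittings: \<open>@\<^sub>v\<close> splits at the actual length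
  of \<open>f s\<close>, \<open>@\<^sub>r\<close> at row \<open>n\<close>.\<close>

lemma hankel1_append_rows:
  assumes "\<And>s. i \<le> s \<Longrightarrow> s \<le> j \<Longrightarrow> f s \<in> carrier_vec n"
    and "\<And>s. i \<le> s \<Longrightarrow> s \<le> j \<Longrightarrow> g s \<in> carrier_vec m"
  shows "hankel1 n f i j @\<^sub>r hankel1 m g i j = hankel1 (n + m) (\<lambda>s. f s @\<^sub>v g s) i j"
proof (rule eq_matI)
  fix r c
  assume "r < dim_row (hankel1 (n + m) (\<lambda>s. f s @\<^sub>v g s) i j)"
    and "c < dim_col (hankel1 (n + m) (\<lambda>s. f s @\<^sub>v g s) i j)"
  then have "r < n + m" and c: "c < Suc j - i"
    by (simp_all add: hankel1_dim)
  then have le: "i \<le> i + c" "i + c \<le> j" by auto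
  show "(hankel1 n f i j @\<^sub>r hankel1 m g i j) $$ (r, c) =
      hankel1 (n + m) (\<lambda>s. f s @\<^sub>v g s) i j $$ (r, c)"
    using \<open>r < n + m\<close> c carrier_vecD[OF assms(1)[OF le]] carrier_vecD[OF assms(2)[OF le]]
    by (auto simp: append_rows_def hankel1_index hankel1_dim)
next
  have "hankel1 n f i j @\<^sub>r hankel1 m g i j \<in> carrier_mat (n + m) (Suc j - i)"
    by (intro carrier_append_rows hankel1_carrier)
  then show "dim_row (hankel1 n f i j @\<^sub>r hankel1 m g i j)
        = dim_row (hankel1 (n + m) (\<lambda>s. f s @\<^sub>v g s) i j)"
    "dim_col (hankel1 n f i j @\<^sub>r hankel1 m g i j)
        = dim_col (hankel1 (n + m) (\<lambda>s. f s @\<^sub>v g s) i j)"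
    by (simp_all only: carrier_matD hankel1_dim)
qed

text \<open>Each column of the product is the functional evaluated at one joint sample. For
  \<open>t \<ge> 1\<close> there are exactly \<open>t\<close> columns; at \<open>t = 0\<close>
  truncated subtraction would leave one.\<close>

lemma annihilating_pair_iff:
  assumes t: "t \<ge> 1"
    and x: "\<And>s. s < t \<Longrightarrow> x s \<in> carrier_vec n" and u: "\<And>s. s < t \<Longrightarrow> u s \<in> carrier_vec m"
  shows "annihilating_pair n m x u t \<xi> \<eta> \<longleftrightarrow>
    \<xi> \<in> carrier_vec n \<and> \<eta> \<in> carrier_vec m \<and> \<eta> \<noteq> 0\<^sub>v m \<and>
    (\<forall>s<t. \<xi> \<bullet> x s + \<eta> \<bullet> u s = 0)"
proof (cases "\<xi> \<in> carrier_vec n \<and> \<eta> \<in> carrier_vec m")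
  case True
  let ?w = "\<lambda>s. x s @\<^sub>v u s"
  let ?H = "hankel1 (n + m) ?w 0 (t - 1)"
  have H: "?H \<in> carrier_mat (n + m) t" using hankel1_carrier[of "n + m" ?w 0 "t - 1"] t by simp
  have app: "hankel1 n x 0 (t - 1) @\<^sub>r hankel1 m u 0 (t - 1) = ?H"
    by (rule hankel1_append_rows) (use x u t in auto)
  have ent: "(mat_of_row (\<xi> @\<^sub>v \<eta>) * ?H) $$ (0, s) = \<xi> \<bullet> x s + \<eta> \<bullet> u s" if s: "s < t" for s
  proof -
    have "col ?H s = ?w s"
      using H s x[OF s] u[OF s] by (intro eq_vecI) (auto simp: hankel1_index)
    then have "(mat_of_row (\<xi> @\<^sub>v \<eta>) * ?H) $$ (0, s) = (\<xi> @\<^sub>v \<eta>) \<bullet> ?w s"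
      using H s by simp
    also have "\<dots> = \<xi> \<bullet> x s + \<eta> \<bullet> u s"
      using True x[OF s] u[OF s] by (intro scalar_prod_append) auto
    finally show ?thesis .
  qed
  have "mat_of_row (\<xi> @\<^sub>v \<eta>) * ?H = 0\<^sub>m 1 t \<longleftrightarrow> (\<forall>s<t. \<xi> \<bullet> x s + \<eta> \<bullet> u s = 0)"
  proof
    assume eq: "mat_of_row (\<xi> @\<^sub>v \<eta>) * ?H = 0\<^sub>m 1 t"
    show "\<forall>s<t. \<xi> \<bullet> x s + \<eta> \<bullet> u s = 0"
      using ent unfolding eq by auto
  next
    assume "\<forall>s<t. \<xi> \<bullet> x s + \<eta> \<bullet> u s = 0"
    then show "mat_of_row (\<xi> @\<^sub>v \<eta>) * ?H = 0\<^sub>m 1 t"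
      using H ent by (intro eq_matI) (auto simp del: index_mult_mat(1))
  qed
  then show ?thesis unfolding annihilating_pair_def app by simp
qed (auto simp: annihilating_pair_def)

text \<open>The column space consists of the products \<open>?H *\<^sub>v y\<close>, and the entries
  of \<open>y\<close> serve as coefficients.\<close>

lemma in_past_span_iff:
  assumes t: "t \<ge> 1" and x: "x t \<in> carrier_vec n"
  shows "in_past_span n x t \<longleftrightarrow> (\<exists>c. \<forall>i<n. x t $ i = (\<Sum>s<t. c s * x s $ i))"
proof -
  let ?H = "hankel1 n x 0 (t - 1)"
  have H: "?H \<in> carrier_mat n t" using hankel1_carrier[of n x 0 "t - 1"] t by simp
  have ent: "(?H *\<^sub>v y) $ i = (\<Sum>s<t. y $ s * x s $ i)" if "y \<in> carrier_vec t" "i < n" for y i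
    using that H
    by (auto simp: scalar_prod_def hankel1_index lessThan_atLeast0 mult.commute intro!: sum.cong)
  have "in_past_span n x t \<longleftrightarrow> (\<exists>y\<in>carrier_vec t. ?H *\<^sub>v y = x t)"
    unfolding in_past_span_def using vec_space.col_space_eq[OF H] H x by auto
  also have "\<dots> \<longleftrightarrow> (\<exists>c. \<forall>i<n. x t $ i = (\<Sum>s<t. c s * x s $ i))"
  proof
    assume "\<exists>y\<in>carrier_vec t. ?H *\<^sub>v y = x t"
    then obtain y where "y \<in> carrier_vec t" "?H *\<^sub>v y = x t" by blast
    then show "\<exists>c. \<forall>i<n. x t $ i = (\<Sum>s<t. c s * x s $ i)"
      using ent by (intro exI[of _ "($) y"]) metis
  next
    assume "\<exists>c. \<forall>i<n. x t $ i = (\<Sum>s<t. c s * x s $ i)"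
    then obtain c where c: "\<And>i. i < n \<Longrightarrow> x t $ i = (\<Sum>s<t. c s * x s $ i)" by blast
    have "?H *\<^sub>v vec t c = x t"
    proof (rule eq_vecI)
      fix i assume "i < dim_vec (x t)"
      then have i: "i < n" using x by simp
      show "(?H *\<^sub>v vec t c) $ i = x t $ i"
        using ent[of "vec t c", OF _ i] c[OF i] by simp
    qed (use H x in auto)
    then show "\<exists>y\<in>carrier_vec t. ?H *\<^sub>v y = x t" by (meson vec_carrier)
  qed
  finally show ?thesis .
qed

text \<open>By linearity; in the feasibility proof this extends orthogonality from the past states
  to the current one.\<close>

lemma in_past_span_orthogonal:
  assumes t: "t \<ge> 1" and x: "\<And>s. s \<le> t \<Longrightarrow> x s \<in> carrier_vec n"
    and span: "in_past_span n x t" and z: "z \<in> carrier_vec n" and orth: "\<And>s. s < t \<Longrightarrow> z \<bullet> x s = 0"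
  shows "z \<bullet> x t = 0"
proof -
  obtain c where c: "\<And>i. i < n \<Longrightarrow> x t $ i = (\<Sum>s<t. c s * x s $ i)"
    using span in_past_span_iff[OF t x] by auto
  have dim: "dim_vec (x s) = n" if "s \<le> t" for s using x[OF that] by simp
  have "z \<bullet> x t = (\<Sum>i<n. \<Sum>s<t. c s * (z $ i * x s $ i))"
    using c dim by (auto simp: scalar_prod_def lessThan_atLeast0 sum_distrib_left mult_ac
        intro!: sum.cong)
  also have "\<dots> = (\<Sum>s<t. \<Sum>i<n. c s * (z $ i * x s $ i))" by (rule sum.swap)
  also have "\<dots> = (\<Sum>s<t. c s * (z \<bullet> x s))"
    using dim by (auto simp: scalar_prod_def lessThan_atLeast0 sum_distrib_left intro!: sum.cong)
  finally show ?thesis using orth by simp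
qed

section \<open>States and controllability\<close>

lemma state_carrier:
  assumes "A \<in> carrier_mat n n" "B \<in> carrier_mat n m" "x0 \<in> carrier_vec n"
    and "\<And>s. s < t \<Longrightarrow> u s \<in> carrier_vec m"
  shows "state A B x0 u t \<in> carrier_vec n"
  using assms(4) by (induction t) (use assms(1-3) in \<open>auto intro!: add_carrier_vec\<close>)

text \<open>Dual form of the Kalman rank condition: the vectors paired with \<open>z\<close> are the
  columns of the controllability matrix, which has full rank.\<close>

lemma controllable_orthogonal_zero:
  assumes A: "A \<in> carrier_mat n n" and B: "B \<in> carrier_mat n m" and "controllable n A B"
    and z: "z \<in> carrier_vec n"
    and orth: "\<And>k j. k < n \<Longrightarrow> j < m \<Longrightarrow> z \<bullet> ((A ^\<^sub>m k) *\<^sub>v col B j) = 0"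
  shows "z = 0\<^sub>v n"
proof -
  let ?L = "concat (map (\<lambda>k. cols (A ^\<^sub>m k * B)) [0..<n])"
  have AB: "A ^\<^sub>m k * B \<in> carrier_mat n m" for k using mult_carrier_mat[OF pow_carrier_mat[OF A] B] .
  have L: "set ?L \<subseteq> carrier_vec n" using cols_dim[of "A ^\<^sub>m _ * B"] A by fastforce
  have "z \<bullet> c = 0" if c: "c \<in> set ?L" for c
  proof -
    obtain k where k: "k < n" "c \<in> set (cols (A ^\<^sub>m k * B))" using c by auto
    then obtain j where "j < m" "c = col (A ^\<^sub>m k * B) j"
      using AB[of k] by (auto simp: cols_def)
    then show ?thesis using orth[OF k(1)] col_mult2[of "A ^\<^sub>m k" n n B m j] A B by simp
  qed
  then show ?thesis
    using full_rank_orthogonal_zero[of "controllability_mat n A B" n "length ?L" z] L z assms(3)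
    unfolding controllable_def controllability_mat_def by simp
qed

section \<open>Feasibility of rule (b)\<close>

lemma annihilating_pair_exists:
  assumes A: "A \<in> carrier_mat n n" and B: "B \<in> carrier_mat n m" and ctrl: "controllable n A B"
    and x0: "x0 \<in> carrier_vec n" and u: "\<And>s. s < t \<Longrightarrow> u s \<in> carrier_vec m"
    and t: "1 \<le> t" "t < n + m" and span: "in_past_span n (state A B x0 u) t"
  shows "\<exists>\<xi> \<eta>. annihilating_pair n m (state A B x0 u) u t \<xi> \<eta>"
proof (rule ccontr)
  define x where "x = state A B x0 u"
  have x: "x s \<in> carrier_vec n" if "s \<le> t" for s
    unfolding x_def using state_carrier[OF A B x0] u that by simp
  assume "\<nexists>\<xi> \<eta>. annihilating_pair n m (state A B x0 u) u t \<xi> \<eta>"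
  then have none: "\<eta> = 0\<^sub>v m"
    if "\<xi> \<in> carrier_vec n" "\<eta> \<in> carrier_vec m" "\<And>s. s < t \<Longrightarrow> \<xi> \<bullet> x s + \<eta> \<bullet> u s = 0" for \<xi> \<eta>
    using that annihilating_pair_iff[of t x n u m \<xi> \<eta>] t x u by (auto simp: x_def)
  obtain z where z: "z \<in> carrier_vec (n + m)" "z \<noteq> 0\<^sub>v (n + m)"
      "\<And>s. s < t \<Longrightarrow> z \<bullet> (x s @\<^sub>v u s) = 0"
    using exists_orthogonal_vec[of t "\<lambda>s. x s @\<^sub>v u s" "n + m"] x u t by auto
  define \<xi> where "\<xi> = vec_first z n"
  have \<xi>: "\<xi> \<in> carrier_vec n" and z_eq: "z = \<xi> @\<^sub>v vec_last z m"
    using z by (auto simp: \<xi>_def)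
  have ann: "\<xi> \<bullet> x s + vec_last z m \<bullet> u s = 0" if s: "s < t" for s
    using scalar_prod_append[OF \<xi>, of "vec_last z m" m "x s" "u s"] z(3)[OF s] x[of s] u[OF s] s z_eq
    by simp
  have last0: "vec_last z m = 0\<^sub>v m" using none[OF \<xi> _ ann] by simp
  have x\<xi>: "\<xi> \<bullet> x s = 0" if "s < t" for s
    using ann[OF that] u[OF that] by (simp add: last0)
  \<comment> \<open>Stated for every \<open>\<zeta>\<close> orthogonal to the past states, since it
    is applied not only to \<open>\<xi>\<close> but to its images under powers of the transpose of
    \<open>A\<close>.\<close>
  have step: "\<zeta> \<bullet> (A *\<^sub>v x s) = 0 \<and> transpose_mat B *\<^sub>v \<zeta> = 0\<^sub>v m"
    if \<zeta>: "\<zeta> \<in> carrier_vec n" "\<And>s. s < t \<Longrightarrow> \<zeta> \<bullet> x s = 0" and s: "s < t" for \<zeta> s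
  proof -
    \<comment> \<open>The span hypothesis enters here: it covers the last shift, from
      \<open>t - 1\<close> to \<open>t\<close>.\<close>
    have "\<zeta> \<bullet> x t = 0"
      using in_past_span_orthogonal[of t x n \<zeta>] t x span \<zeta> by (auto simp: x_def)
    then have suc: "\<zeta> \<bullet> x (Suc s) = 0" if "s < t" for s
      using \<zeta>(2) that by (cases "Suc s = t") auto
    have split: "\<zeta> \<bullet> x (Suc s) = \<zeta> \<bullet> (A *\<^sub>v x s) + (transpose_mat B *\<^sub>v \<zeta>) \<bullet> u s" if "s < t" for s
    proof -
      have "\<zeta> \<bullet> x (Suc s) = \<zeta> \<bullet> (A *\<^sub>v x s) + \<zeta> \<bullet> (B *\<^sub>v u s)"
        using scalar_prod_add_distrib[OF \<zeta>(1), of "A *\<^sub>v x s" "B *\<^sub>v u s"] A B x[of s] u that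
        by (simp add: x_def)
      then show ?thesis using transpose_vec_mult_scalar[OF B u[OF that] \<zeta>(1)] by simp
    qed
    \<comment> \<open>The pair of transposed images of \<open>\<zeta>\<close> takes the value
      \<open>\<zeta> \<bullet> x (Suc s)\<close> at sample \<open>s\<close>, hence annihilates the
      past, and \<open>none\<close> kills its input part.\<close>
    have "transpose_mat B *\<^sub>v \<zeta> = 0\<^sub>v m"
    proof (rule none)
      show "transpose_mat A *\<^sub>v \<zeta> \<in> carrier_vec n" "transpose_mat B *\<^sub>v \<zeta> \<in> carrier_vec m"
        using A B \<zeta> by auto
      show "(transpose_mat A *\<^sub>v \<zeta>) \<bullet> x s + (transpose_mat B *\<^sub>v \<zeta>) \<bullet> u s = 0" if "s < t" for s
        using suc[OF that] split[OF that] transpose_vec_mult_scalar[OF A x \<zeta>(1)] that by simp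
    qed
    then show ?thesis using suc[OF s] split[OF s] u[OF s] by simp
  qed
  \<comment> \<open>\<open>\<zeta>\<close> plays the role of the \<open>k\<close>-th power of the
    transpose of \<open>A\<close> applied to \<open>\<xi>\<close>; describing it by its pairings
    avoids transposing powers.\<close>
  have iter: "\<exists>\<zeta>\<in>carrier_vec n. (\<forall>v\<in>carrier_vec n. \<zeta> \<bullet> v = \<xi> \<bullet> ((A ^\<^sub>m k) *\<^sub>v v)) \<and>
      (\<forall>s<t. \<zeta> \<bullet> x s = 0)" for k
  proof (induction k)
    case 0
    then show ?case using \<xi> x\<xi> A by (intro bexI[of _ \<xi>]) auto
  next
    case (Suc k)
    then obtain \<zeta> where \<zeta>: "\<zeta> \<in> carrier_vec n" "\<And>s. s < t \<Longrightarrow> \<zeta> \<bullet> x s = 0"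
      "\<And>v. v \<in> carrier_vec n \<Longrightarrow> \<zeta> \<bullet> v = \<xi> \<bullet> ((A ^\<^sub>m k) *\<^sub>v v)" by blast
    have tr: "(transpose_mat A *\<^sub>v \<zeta>) \<bullet> v = \<zeta> \<bullet> (A *\<^sub>v v)" if "v \<in> carrier_vec n" for v
      using transpose_vec_mult_scalar[OF A that \<zeta>(1)] .
    show ?case
    proof (intro bexI[of _ "transpose_mat A *\<^sub>v \<zeta>"] conjI ballI allI impI)
      fix v :: "real vec" assume v: "v \<in> carrier_vec n"
      have "(A ^\<^sub>m Suc k) *\<^sub>v v = (A ^\<^sub>m k) *\<^sub>v (A *\<^sub>v v)"
        using assoc_mult_mat_vec[OF pow_carrier_mat[OF A] A v] by simp
      then show "(transpose_mat A *\<^sub>v \<zeta>) \<bullet> v = \<xi> \<bullet> ((A ^\<^sub>m Suc k) *\<^sub>v v)"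
        using tr[OF v] \<zeta>(3)[of "A *\<^sub>v v"] A v by simp
    next
      fix s assume "s < t"
      then show "(transpose_mat A *\<^sub>v \<zeta>) \<bullet> x s = 0" using tr[OF x] step[OF \<zeta>(1,2)] by simp
    qed (use A \<zeta> in auto)
  qed
  have "\<xi> = 0\<^sub>v n"
  proof (rule controllable_orthogonal_zero[OF A B ctrl \<xi>])
    fix k j assume j: "j < m"
    obtain \<zeta> where \<zeta>: "\<zeta> \<in> carrier_vec n" "\<And>s. s < t \<Longrightarrow> \<zeta> \<bullet> x s = 0"
      "\<And>v. v \<in> carrier_vec n \<Longrightarrow> \<zeta> \<bullet> v = \<xi> \<bullet> ((A ^\<^sub>m k) *\<^sub>v v)" using iter[of k] by blast
    have cB: "col B j \<in> carrier_vec n" using B j by auto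
    have "transpose_mat B *\<^sub>v \<zeta> = 0\<^sub>v m" using step[OF \<zeta>(1,2), of 0] t by simp
    then have "(transpose_mat B *\<^sub>v \<zeta>) $ j = 0" using j by simp
    then have "col B j \<bullet> \<zeta> = 0" using B j by simp
    then show "\<xi> \<bullet> ((A ^\<^sub>m k) *\<^sub>v col B j) = 0"
      using \<zeta>(3)[OF cB] comm_scalar_prod[OF cB \<zeta>(1)] by simp
  qed
  then have "z = 0\<^sub>v (n + m)" using z_eq last0 by auto
  then show False using z(2) by simp
qed

section \<open>Full rank of the selected samples\<close>

lemma rank_selected_samples:
  assumes T: "T = n + m" "1 \<le> T" and u: "\<And>s. s < T \<Longrightarrow> u s \<in> carrier_vec m"
    and x: "\<And>s. s < T \<Longrightarrow> x s \<in> carrier_vec n"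
    and u0: "u 0 \<noteq> 0\<^sub>v m"
    and adm: "\<And>t. 1 \<le> t \<Longrightarrow> t < T \<Longrightarrow> admissible_input n m x u t"
  shows "vec_space.rank (n + m) (hankel1 n x 0 (T - 1) @\<^sub>r hankel1 m u 0 (T - 1)) = n + m"
proof -
  let ?w = "\<lambda>s. x s @\<^sub>v u s"
  let ?H = "hankel1 (n + m) ?w 0 (T - 1)"
  have H: "?H \<in> carrier_mat (n + m) (n + m)"
    using hankel1_carrier[of "n + m" ?w 0 "T - 1"] T
    by (metis Suc_diff_le diff_Suc_1 diff_zero)
  have app: "hankel1 n x 0 (T - 1) @\<^sub>r hankel1 m u 0 (T - 1) = ?H"
    by (rule hankel1_append_rows) (use x u T in auto)
  have "det ?H \<noteq> 0"
  proof
    assume "det ?H = 0"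
    then obtain v where v: "v \<in> carrier_vec (n + m)" "v \<noteq> 0\<^sub>v (n + m)" "?H *\<^sub>v v = 0\<^sub>v (n + m)"
      using det_0_iff_vec_prod_zero_field[OF H] by auto
    define k where "k = (GREATEST k. k < T \<and> v $ k \<noteq> 0)"
    have "\<exists>k. k < T \<and> v $ k \<noteq> 0"
      using v(1,2) T by (metis carrier_vecD eq_vecI index_zero_vec(1,2))
    then have k: "k < T" "v $ k \<noteq> 0"
      unfolding k_def using GreatestI_ex_nat[of "\<lambda>k. k < T \<and> v $ k \<noteq> 0" T] by auto
    have above: "v $ s = 0" if "k < s" "s < T" for s
      using Greatest_le_nat[of "\<lambda>k. k < T \<and> v $ k \<noteq> 0" s T] that unfolding k_def by fastforce
    \<comment> \<open>The kernel equation truncated at \<open>k\<close>, because all later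
      coefficients vanish; its state and input rows are then separated.\<close>
    have rel: "(\<Sum>s<k. v $ s * ?w s $ i) + v $ k * ?w k $ i = 0" if i: "i < n + m" for i
    proof -
      have "0 = (?H *\<^sub>v v) $ i" using v(3) i by simp
      also have "\<dots> = (\<Sum>s<T. v $ s * ?w s $ i)"
        using H v(1) i T
        by (auto simp: scalar_prod_def hankel1_index lessThan_atLeast0 mult.commute
            simp del: index_append_vec intro!: sum.cong)
      also have "\<dots> = (\<Sum>s<Suc k. v $ s * ?w s $ i)"
        by (rule sum.mono_neutral_right) (use above k in auto)
      finally show ?thesis by simp
    qed
    have relx: "(\<Sum>s<k. v $ s * x s $ i) + v $ k * x k $ i = 0" if i: "i < n" for i
    proof -
      have "?w s $ i = x s $ i" if "s \<le> k" for s
        using x[of s] u[of s] k that i by simp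
      then show ?thesis using rel[of i] i by (simp del: index_append_vec)
    qed
    have relu: "(\<Sum>s<k. v $ s * u s $ i) + v $ k * u k $ i = 0" if i: "i < m" for i
    proof -
      have "?w s $ (n + i) = u s $ i" if "s \<le> k" for s
        using x[of s] u[of s] k that i by simp
      then show ?thesis using rel[of "n + i"] i by (simp del: index_append_vec)
    qed
    show False
    \<comment> \<open>For \<open>k = 0\<close> the relation reduces to a nonzero multiple of
      \<open>u 0\<close> being zero.\<close>
    proof (cases "k = 0")
      case True
      then have "u 0 $ i = 0" if "i < m" for i using relu[OF that] k by simp
      then show False using u0 u[of 0] k T by (metis True carrier_vecD eq_vecI index_zero_vec)
    next
      case False
      then have k1: "1 \<le> k" by simp
      have "in_past_span n x k"
        unfolding in_past_span_iff[of k x n, OF k1 x[OF k(1)]]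
      \<comment> \<open>The coefficients come from solving the kernel relation for
        \<open>x k\<close>, dividing by \<open>v $ k\<close>.\<close>
      proof (intro exI[of _ "\<lambda>s. - v $ s / v $ k"] allI impI)
        fix i assume i: "i < n"
        have "v $ k * x k $ i = - (\<Sum>s<k. v $ s * x s $ i)" using relx[OF i] by linarith
        then have "x k $ i = - (\<Sum>s<k. v $ s * x s $ i) / v $ k" using k by (simp add: field_simps)
        then show "x k $ i = (\<Sum>s<k. - v $ s / v $ k * x s $ i)"
          by (simp add: sum_divide_distrib sum_negf)
      qed
      then obtain \<xi> \<eta> where ann: "annihilating_pair n m x u k \<xi> \<eta>"
          and ne: "\<xi> \<bullet> x k + \<eta> \<bullet> u k \<noteq> 0"
        using adm[OF k1 k(1)] unfolding admissible_input_def by blast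
      have ann': "\<xi> \<bullet> x s + \<eta> \<bullet> u s = 0" if "s < k" for s
        using ann annihilating_pair_iff[of k x n u m \<xi> \<eta>] k1 x u k that by auto
      have sp: "\<xi> \<bullet> x s + \<eta> \<bullet> u s = (\<Sum>i<n. \<xi> $ i * x s $ i) + (\<Sum>i<m. \<eta> $ i * u s $ i)"
        if "s \<le> k" for s
        using x[of s] u[of s] k that by (simp add: scalar_prod_def lessThan_atLeast0)
      \<comment> \<open>Applying the functional to the kernel relation gives 0, yet the terms below
        \<open>k\<close> vanish by \<open>ann'\<close> and the term at \<open>k\<close> does not by
        \<open>ne\<close>.\<close>
      have "(\<Sum>s<Suc k. v $ s * (\<xi> \<bullet> x s + \<eta> \<bullet> u s))
          = (\<Sum>s<Suc k. (\<Sum>i<n. \<xi> $ i * (v $ s * x s $ i)) + (\<Sum>i<m. \<eta> $ i * (v $ s * u s $ i)))"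
        by (rule sum.cong) (simp_all add: sp distrib_left sum_distrib_left mult.left_commute)
      also have "\<dots> = (\<Sum>i<n. \<xi> $ i * (\<Sum>s<Suc k. v $ s * x s $ i))
          + (\<Sum>i<m. \<eta> $ i * (\<Sum>s<Suc k. v $ s * u s $ i))"
        unfolding sum.distrib sum_distrib_left by (intro arg_cong2[of _ _ _ _ "(+)"] sum.swap)
      also have "\<dots> = 0" using relx relu by simp
      finally show False using ann' ne k by simp
    qed
  qed
  \<comment> \<open>Since \<open>T = n + m\<close>, the matrix is square and a nonzero determinant
    means full rank.\<close>
  then show ?thesis unfolding app using vec_space.det_rank_iff[OF H] by blast
qed

theorem theorem1:
  fixes n m T :: nat and A B :: "real mat" and x0 :: "real vec"
  assumes "n \<ge> 1" and "m \<ge> 1"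
    and "A \<in> carrier_mat n n" and "B \<in> carrier_mat n m"
    and "controllable n A B"
    and "T = n + m"
    and "x0 \<in> carrier_vec n"
  shows "(\<forall>t\<in>{1..T - 1}. \<forall>u. selected_inputs n m A B x0 u t \<longrightarrow>
            in_past_span n (state A B x0 u) t \<longrightarrow>
            (\<exists>\<xi> \<eta>. annihilating_pair n m (state A B x0 u) u t \<xi> \<eta>))
       \<and> (\<forall>u. selected_inputs n m A B x0 u T \<longrightarrow>
            vec_space.rank (n + m)
              (hankel1 n (state A B x0 u) 0 (T - 1) @\<^sub>r hankel1 m u 0 (T - 1)) = n + m)"
proof (intro conjI ballI allI impI)
  fix t u
  assume "t \<in> {1..T - 1}" "selected_inputs n m A B x0 u t" "in_past_span n (state A B x0 u) t"
  then show "\<exists>\<xi> \<eta>. annihilating_pair n m (state A B x0 u) u t \<xi> \<eta>"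
    using assms by (intro annihilating_pair_exists) (auto simp: selected_inputs_def)
next
  fix u
  assume sel: "selected_inputs n m A B x0 u T"
  show "vec_space.rank (n + m)
      (hankel1 n (state A B x0 u) 0 (T - 1) @\<^sub>r hankel1 m u 0 (T - 1)) = n + m"
    by (rule rank_selected_samples)
      (use sel assms in \<open>auto simp: selected_inputs_def intro!: state_carrier\<close>)
qed

end
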